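(* Let $R$ be any ring. Then $R$ is a $\sqrt{J}$-clean ring if and only if $R/J(R)$ is a $\sqrt{J}$-clean ring and idempotents lift modulo $J(R)$.
   Context: Rings are associative with identity $1\neq 0$ (not necessarily commutative). $J(R)$ is the Jacobson radical of $R$, and $\sqrt{J(R)}=\{z\in R : z^n\in J(R)\text{ for some } n\ge 1\}$ (a subset of $R$, not necessarily closed under addition or multiplication). An element $x\in R$ is $\sqrt{J}$-clean if $x=e+z$ for some idempotent $e\in R$ and some $z\in\sqrt{J(R)}$; $R$ is a $\sqrt{J}$-clean ring if every element of $R$ is $\sqrt{J}$-clean. Idempotents lift modulo $J(R)$ means: whenever $x\in R$ satisfies $x^2-x\in J(R)$, there is an idempotent $e\in R$ with $x-e\in J(R)$. *)

theory Defs
  imports "HOL-Algebra.Algebra"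
begin

text \<open>The library's \<^const>\<open>ideal\<close> and \<^const>\<open>maximalideal\<close> are two-sided; over a
  noncommutative ring the Jacobson radical needs one-sided ideals.\<close>

definition left_ideal :: "'a set \<Rightarrow> ('a, 'b) ring_scheme \<Rightarrow> bool" where
  "left_ideal I R \<longleftrightarrow>
     additive_subgroup I R \<and> (\<forall>a\<in>I. \<forall>r\<in>carrier R. r \<otimes>\<^bsub>R\<^esub> a \<in> I)"

definition maximal_left_ideal :: "'a set \<Rightarrow> ('a, 'b) ring_scheme \<Rightarrow> bool" where
  "maximal_left_ideal M R \<longleftrightarrow>
     left_ideal M R \<and> M \<noteq> carrier R \<and>
     (\<forall>I. left_ideal I R \<longrightarrow> M \<subseteq> I \<longrightarrow> I = M \<or> I = carrier R)"

text \<open>The intersection with \<^term>\<open>carrier R\<close> matters only for the zero ring, which has no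
  maximal left ideals.\<close>

definition jacobson_radical :: "('a, 'b) ring_scheme \<Rightarrow> 'a set" where
  "jacobson_radical R = carrier R \<inter> \<Inter>{M. maximal_left_ideal M R}"

definition sqrtJ :: "('a, 'b) ring_scheme \<Rightarrow> 'a set" where
  "sqrtJ R = {z \<in> carrier R. \<exists>n::nat. n \<ge> 1 \<and> z [^]\<^bsub>R\<^esub> n \<in> jacobson_radical R}"

definition idempotent_elem :: "('a, 'b) ring_scheme \<Rightarrow> 'a \<Rightarrow> bool" where
  "idempotent_elem R e \<longleftrightarrow> e \<in> carrier R \<and> e \<otimes>\<^bsub>R\<^esub> e = e"

definition sqrtJ_clean :: "('a, 'b) ring_scheme \<Rightarrow> 'a \<Rightarrow> bool" where
  "sqrtJ_clean R x \<longleftrightarrow> (\<exists>e z. idempotent_elem R e \<and> z \<in> sqrtJ R \<and> x = e \<oplus>\<^bsub>R\<^esub> z)"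

text \<open>HOL-Algebra's \<^locale>\<open>ring\<close> is associative and unital but allows the zero ring.\<close>

definition sqrtJ_clean_ring :: "('a, 'b) ring_scheme \<Rightarrow> bool" where
  "sqrtJ_clean_ring R \<longleftrightarrow>
     ring R \<and> \<one>\<^bsub>R\<^esub> \<noteq> \<zero>\<^bsub>R\<^esub> \<and> (\<forall>x\<in>carrier R. sqrtJ_clean R x)"

definition idempotents_lift_mod :: "('a, 'b) ring_scheme \<Rightarrow> 'a set \<Rightarrow> bool" where
  "idempotents_lift_mod R I \<longleftrightarrow>
     (\<forall>x\<in>carrier R. x \<otimes>\<^bsub>R\<^esub> x \<ominus>\<^bsub>R\<^esub> x \<in> I \<longrightarrow>
        (\<exists>e. idempotent_elem R e \<and> x \<ominus>\<^bsub>R\<^esub> e \<in> I))"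

end

theory Submission
  imports Defs
begin

text \<open>Write \<open>\<pi> : R \<rightarrow> R/J\<close> for the projection onto the quotient by the Jacobson radical. Because
  \<open>J(R/J) = 0\<close>, an element \<open>z\<close> lies in \<open>sqrtJ R\<close> exactly when \<open>\<pi> z\<close> is nilpotent, and exactly when
  \<open>\<pi> z\<close> lies in \<open>sqrtJ (R/J)\<close> (lemma \<open>sqrtJ_iff\<close> below). Hence decompositions \<open>x = e + z\<close> map
  to such decompositions of \<open>\<pi> x\<close>, and a decomposition of \<open>\<pi> x\<close> comes from one of \<open>x\<close> as soon as
  its idempotent lifts to an idempotent of \<open>R\<close>.

  What remains is that idempotents lift when \<open>R\<close> is clean in this sense. If \<open>\<pi> x\<close> is idempotent and
  \<open>x = e + z\<close>, then the idempotents \<open>\<pi> x\<close> and \<open>\<pi> e\<close> have a nilpotent difference. They need not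
  commute, so this does not make them equal, but it does make them conjugate: for idempotents
  \<open>e\<close>, \<open>f\<close> the element \<open>u = ef + (1 - e)(1 - f)\<close> satisfies \<open>eu = ef = uf\<close>, and multiplying it on
  either side by \<open>fe + (1 - f)(1 - e)\<close> gives \<open>1 - (f - e)\<^sup>2\<close>, which is a unit when \<open>f - e\<close> is
  nilpotent (lemma \<open>idempotents_conjugate\<close>). Units of \<open>R/J\<close> lift to units of \<open>R\<close>, so \<open>\<pi> x\<close> is
  the image of a conjugate of \<open>e\<close>, and a conjugate of an idempotent is idempotent.\<close>

section \<open>Left ideals and maximal left ideals\<close>

lemma left_idealD:
  assumes "left_ideal I R"
  shows "I \<subseteq> carrier R" and "\<zero>\<^bsub>R\<^esub> \<in> I"
    and "\<And>a b. a \<in> I \<Longrightarrow> b \<in> I \<Longrightarrow> a \<oplus>\<^bsub>R\<^esub> b \<in> I"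
    and "\<And>a r. a \<in> I \<Longrightarrow> r \<in> carrier R \<Longrightarrow> r \<otimes>\<^bsub>R\<^esub> a \<in> I"
proof -
  have sub: "additive_subgroup I R" using assms unfolding left_ideal_def by blast
  show "I \<subseteq> carrier R" using sub by (rule additive_subgroup.a_subset)
  show "\<zero>\<^bsub>R\<^esub> \<in> I" using sub by (rule additive_subgroup.zero_closed)
  show "\<And>a b. a \<in> I \<Longrightarrow> b \<in> I \<Longrightarrow> a \<oplus>\<^bsub>R\<^esub> b \<in> I"
    using sub by (rule additive_subgroup.a_closed)
  show "\<And>a r. a \<in> I \<Longrightarrow> r \<in> carrier R \<Longrightarrow> r \<otimes>\<^bsub>R\<^esub> a \<in> I"
    using assms unfolding left_ideal_def by blast
qed

context ring
begin

lemma add_diff_cancels: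
  assumes "a \<in> carrier R" "b \<in> carrier R"
  shows "(a \<oplus> b) \<ominus> a = b" "a \<oplus> (b \<ominus> a) = b" "(b \<ominus> a) \<oplus> a = b"
  using assms by algebra+

lemma left_idealI:
  assumes sub: "I \<subseteq> carrier R" and zero: "\<zero> \<in> I"
    and add: "\<And>a b. a \<in> I \<Longrightarrow> b \<in> I \<Longrightarrow> a \<oplus> b \<in> I"
    and mult: "\<And>a r. a \<in> I \<Longrightarrow> r \<in> carrier R \<Longrightarrow> r \<otimes> a \<in> I"
  shows "left_ideal I R"
proof -
  have "\<ominus> a \<in> I" if "a \<in> I" for a
    using mult[OF that, of "\<ominus> \<one>"] that sub l_minus[of \<one> a] by auto
  then have "subgroup I (add_monoid R)"
    using sub zero add by (intro add.subgroupI) (auto simp: a_inv_def)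
  then show ?thesis
    using mult additive_subgroupI unfolding left_ideal_def by blast
qed

lemma left_ideal_eq_carrier:
  assumes "left_ideal I R" "\<one> \<in> I"
  shows "I = carrier R"
proof -
  have "r \<in> I" if "r \<in> carrier R" for r
    using left_idealD(4)[OF assms that] that by simp
  then show ?thesis using left_idealD(1)[OF assms(1)] by blast
qed

lemma left_ideal_minus:
  assumes "left_ideal I R" "a \<in> I" "b \<in> I"
  shows "a \<ominus> b \<in> I"
proof -
  have "b \<in> carrier R" using assms left_idealD(1) by blast
  then have "\<ominus> \<one> \<otimes> b = \<ominus> b" by (simp add: l_minus)
  then show ?thesis
    using left_idealD(3)[OF assms(1,2)] left_idealD(4)[OF assms(1,3), of "\<ominus> \<one>"]
    by (simp add: minus_eq)
qed

lemma maximal_left_ideal_one_notin: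
  assumes "maximal_left_ideal M R"
  shows "\<one> \<notin> M"
  using assms left_ideal_eq_carrier unfolding maximal_left_ideal_def by blast

text \<open>Zorn's lemma applies because a left ideal is proper iff it omits \<open>\<one>\<close>, a condition that
  passes to unions of chains.\<close>

lemma maximal_left_ideal_exists:
  assumes "left_ideal I R" "\<one> \<notin> I"
  obtains M where "maximal_left_ideal M R" "I \<subseteq> M"
proof -
  define A where "A = {K. left_ideal K R \<and> I \<subseteq> K \<and> \<one> \<notin> K}"
  have "\<exists>M\<in>A. \<forall>K\<in>A. M \<subseteq> K \<longrightarrow> K = M"
  proof (rule subset_Zorn_nonempty)
    show "A \<noteq> {}" using assms unfolding A_def by blast
  next
    fix C assume ne: "C \<noteq> {}" and chain: "subset.chain A C"
    have CA: "\<And>K. K \<in> C \<Longrightarrow> left_ideal K R \<and> I \<subseteq> K \<and> \<one> \<notin> K"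
      using chain unfolding A_def subset.chain_def by blast
    have "left_ideal (\<Union>C) R"
    proof (rule left_idealI)
      show "\<Union>C \<subseteq> carrier R" using CA left_idealD(1) by blast
      show "\<zero> \<in> \<Union>C" using CA left_idealD(2) ne by blast
      show "r \<otimes> a \<in> \<Union>C" if "a \<in> \<Union>C" "r \<in> carrier R" for a r
      proof -
        obtain K where "K \<in> C" "a \<in> K" using \<open>a \<in> \<Union>C\<close> by blast
        then show ?thesis using CA left_idealD(4)[of K R a r] \<open>r \<in> carrier R\<close> by auto
      qed
      show "a \<oplus> b \<in> \<Union>C" if "a \<in> \<Union>C" "b \<in> \<Union>C" for a b
      proof -
        obtain K L where KL: "K \<in> C" "a \<in> K" "L \<in> C" "b \<in> L" using \<open>a \<in> \<Union>C\<close> \<open>b \<in> \<Union>C\<close> by blast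
        have "K \<subseteq> L \<or> L \<subseteq> K"
          using chain KL(1,3) unfolding subset_chain_def by blast
        then have "\<exists>N\<in>C. a \<in> N \<and> b \<in> N" using KL by blast
        then show ?thesis using CA left_idealD(3) by (metis UnionI)
      qed
    qed
    then show "\<Union>C \<in> A" using CA ne unfolding A_def by blast
  qed
  then obtain M where M: "M \<in> A" and max: "\<And>K. K \<in> A \<Longrightarrow> M \<subseteq> K \<Longrightarrow> K = M" by blast
  have "K = M \<or> K = carrier R" if "left_ideal K R" "M \<subseteq> K" for K
    using that M max[of K] left_ideal_eq_carrier[of K] unfolding A_def by blast
  then have "maximal_left_ideal M R"
    using M unfolding A_def maximal_left_ideal_def by blast
  then show ?thesis using that M unfolding A_def by blast
qed

text \<open>The next lemma is what makes the Jacobson radical closed under right multiplication: the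
  annihilator of a nonzero element of the simple module \<open>R/M\<close> is again a maximal left ideal.\<close>

lemma maximal_left_ideal_colon:
  assumes M: "maximal_left_ideal M R" and r: "r \<in> carrier R" "r \<notin> M"
  shows "maximal_left_ideal {x \<in> carrier R. x \<otimes> r \<in> M} R" (is "maximal_left_ideal ?N R")
proof -
  have LM: "left_ideal M R"
    and max: "\<And>K. left_ideal K R \<Longrightarrow> M \<subseteq> K \<Longrightarrow> K = M \<or> K = carrier R"
    using M unfolding maximal_left_ideal_def by blast+
  note MD = left_idealD[OF LM]
  have LN: "left_ideal ?N R"
    by (rule left_idealI) (use MD r in \<open>auto simp: l_distr m_assoc\<close>)
  have "\<one> \<notin> ?N" using r by simp
  then have ne: "?N \<noteq> carrier R" by blast
  have "K = ?N \<or> K = carrier R" if K: "left_ideal K R" "?N \<subseteq> K" for K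
  proof (cases "K \<subseteq> ?N")
    case True
    then show ?thesis using K by blast
  next
    case False
    note KD = left_idealD[OF K(1)]
    obtain y where y: "y \<in> K" "y \<in> carrier R" "y \<otimes> r \<notin> M"
      using False KD(1) by blast
    \<comment> \<open>\<open>P = R(yr) + M\<close> strictly contains \<open>M\<close>, so it is all of \<open>R\<close>. Writing \<open>r = s(yr) + m\<close>
      puts \<open>1 - sy\<close> into the annihilator of \<open>r\<close>, hence into \<open>K\<close>, which also contains \<open>sy\<close>.\<close>
    define P where "P = {s \<otimes> (y \<otimes> r) \<oplus> m | s m. s \<in> carrier R \<and> m \<in> M}"
    have in_P: "s \<otimes> (y \<otimes> r) \<oplus> m \<in> P" if "s \<in> carrier R" "m \<in> M" for s m
      using that unfolding P_def by blast
    have LP: "left_ideal P R"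
    proof (rule left_idealI)
      show "P \<subseteq> carrier R" using MD(1) y r unfolding P_def by auto
      show "\<zero> \<in> P" using in_P[of \<zero> \<zero>] MD(2) y r by simp
    next
      fix a b assume "a \<in> P" "b \<in> P"
      then obtain s m t n where *: "s \<in> carrier R" "m \<in> M" "a = s \<otimes> (y \<otimes> r) \<oplus> m"
        "t \<in> carrier R" "n \<in> M" "b = t \<otimes> (y \<otimes> r) \<oplus> n" unfolding P_def by blast
      moreover have "m \<in> carrier R" "n \<in> carrier R" using * MD(1) by blast+
      ultimately have "a \<oplus> b = (s \<oplus> t) \<otimes> (y \<otimes> r) \<oplus> (m \<oplus> n)"
        using y r by (simp add: l_distr a_ac)
      then show "a \<oplus> b \<in> P" using in_P * MD(3) by simp
    next
      fix a t assume "a \<in> P" and t: "t \<in> carrier R"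
      then obtain s m where *: "s \<in> carrier R" "m \<in> M" "a = s \<otimes> (y \<otimes> r) \<oplus> m"
        unfolding P_def by blast
      moreover have "m \<in> carrier R" using * MD(1) by blast
      ultimately have "t \<otimes> a = (t \<otimes> s) \<otimes> (y \<otimes> r) \<oplus> t \<otimes> m"
        using y r t by (simp add: r_distr m_assoc)
      then show "t \<otimes> a \<in> P" using in_P * MD(4) t by simp
    qed
    have "M \<subseteq> P"
    proof
      fix m assume "m \<in> M"
      then show "m \<in> P" using in_P[of \<zero> m] MD(1) y r by auto
    qed
    moreover have "y \<otimes> r \<in> P" using in_P[of \<one> \<zero>] MD(2) y r by simp
    ultimately have "P = carrier R" using max[OF LP] y by blast
    then obtain s m where s: "s \<in> carrier R" "m \<in> M" "r = s \<otimes> (y \<otimes> r) \<oplus> m"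
      using r unfolding P_def by blast
    have mc: "m \<in> carrier R" using s MD(1) by blast
    have "(\<one> \<ominus> s \<otimes> y) \<otimes> r = r \<ominus> s \<otimes> (y \<otimes> r)"
      using s(1) y r by (simp add: minus_eq l_distr l_minus m_assoc)
    also have "\<dots> = (s \<otimes> (y \<otimes> r) \<oplus> m) \<ominus> s \<otimes> (y \<otimes> r)" using s(3) by simp
    also have "\<dots> = m" using s(1) mc y r by (simp add: add_diff_cancels)
    finally have "\<one> \<ominus> s \<otimes> y \<in> ?N" using s y by simp
    then have "\<one> \<ominus> s \<otimes> y \<in> K" using K(2) by blast
    moreover have "s \<otimes> y \<in> K" using KD(4) s y by blast
    ultimately have "(\<one> \<ominus> s \<otimes> y) \<oplus> s \<otimes> y \<in> K" using KD(3) by blast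
    moreover have "(\<one> \<ominus> s \<otimes> y) \<oplus> s \<otimes> y = \<one>"
      using s y add_diff_cancels(3)[of "s \<otimes> y" \<one>] by simp
    ultimately have "K = carrier R" using left_ideal_eq_carrier[OF K(1)] by simp
    then show ?thesis ..
  qed
  then show ?thesis using LN ne unfolding maximal_left_ideal_def by blast
qed

section \<open>The Jacobson radical\<close>

lemma jacobson_radicalI:
  assumes "a \<in> carrier R" "\<And>M. maximal_left_ideal M R \<Longrightarrow> a \<in> M"
  shows "a \<in> jacobson_radical R"
  using assms unfolding jacobson_radical_def by blast

lemma jacobson_radicalD:
  assumes "a \<in> jacobson_radical R"
  shows "a \<in> carrier R" and "maximal_left_ideal M R \<Longrightarrow> a \<in> M"
  using assms unfolding jacobson_radical_def by blast+

lemma left_ideal_jacobson_radical: "left_ideal (jacobson_radical R) R"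
proof (rule left_idealI)
  show "jacobson_radical R \<subseteq> carrier R" using jacobson_radicalD(1) by blast
qed (auto intro!: jacobson_radicalI intro: left_idealD dest: jacobson_radicalD
      simp: maximal_left_ideal_def)

lemma ideal_jacobson_radical: "ideal (jacobson_radical R) R"
proof (rule idealI)
  show "ring R" by (rule ring_axioms)
  show "subgroup (jacobson_radical R) (add_monoid R)"
    using left_ideal_jacobson_radical additive_subgroup.a_subgroup
    unfolding left_ideal_def by blast
next
  fix a r assume a: "a \<in> jacobson_radical R" and r: "r \<in> carrier R"
  show "r \<otimes> a \<in> jacobson_radical R"
    using left_idealD(4)[OF left_ideal_jacobson_radical a r] .
  show "a \<otimes> r \<in> jacobson_radical R"
  proof (rule jacobson_radicalI)
    show "a \<otimes> r \<in> carrier R" using jacobson_radicalD(1)[OF a] r by simp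
    fix M assume M: "maximal_left_ideal M R"
    show "a \<otimes> r \<in> M"
    proof (cases "r \<in> M")
      case True
      then show ?thesis
        using M left_idealD(4)[of M R r a] jacobson_radicalD(1)[OF a]
        unfolding maximal_left_ideal_def by simp
    next
      case False
      then show ?thesis
        using jacobson_radicalD(2)[OF a maximal_left_ideal_colon[OF M r]] by simp
    qed
  qed
qed

lemma one_notin_jacobson_radical:
  assumes "\<one> \<noteq> \<zero>"
  shows "\<one> \<notin> jacobson_radical R"
proof -
  have "left_ideal {\<zero>} R" by (rule left_idealI) auto
  then obtain M where "maximal_left_ideal M R"
    using maximal_left_ideal_exists[of "{\<zero>}"] assms by blast
  then show ?thesis using maximal_left_ideal_one_notin jacobson_radicalD(2) by blast
qed

text \<open>Otherwise the left ideal \<open>R(1 + a)\<close> would be proper and so lie in a maximal left ideal, which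
  contains \<open>a\<close> as well and hence \<open>\<one>\<close>.\<close>

lemma jacobson_radical_left_inverse:
  assumes a: "a \<in> jacobson_radical R"
  obtains b where "b \<in> carrier R" "b \<otimes> (\<one> \<oplus> a) = \<one>"
proof (rule ccontr)
  note aD = jacobson_radicalD[OF a]
  let ?L = "{b \<otimes> (\<one> \<oplus> a) | b. b \<in> carrier R}"
  assume "\<not> thesis"
  then have "\<one> \<notin> ?L" using that by force
  moreover have "left_ideal ?L R"
  proof (rule left_idealI)
    show "?L \<subseteq> carrier R" using aD(1) by auto
    have "\<zero> = \<zero> \<otimes> (\<one> \<oplus> a)" using aD(1) by simp
    then show "\<zero> \<in> ?L" by blast
  next
    fix x y assume "x \<in> ?L" "y \<in> ?L"
    then obtain b c where "b \<in> carrier R" "x = b \<otimes> (\<one> \<oplus> a)" "c \<in> carrier R" "y = c \<otimes> (\<one> \<oplus> a)"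
      by blast
    moreover from this have "x \<oplus> y = (b \<oplus> c) \<otimes> (\<one> \<oplus> a)" using aD(1) by (simp add: l_distr)
    ultimately show "x \<oplus> y \<in> ?L" by blast
  next
    fix x r assume "x \<in> ?L" and r: "r \<in> carrier R"
    then obtain b where "b \<in> carrier R" "x = b \<otimes> (\<one> \<oplus> a)" by blast
    moreover from this have "r \<otimes> x = (r \<otimes> b) \<otimes> (\<one> \<oplus> a)" using aD(1) r by (simp add: m_assoc)
    ultimately show "r \<otimes> x \<in> ?L" using r by blast
  qed
  ultimately obtain M where M: "maximal_left_ideal M R" "?L \<subseteq> M"
    using maximal_left_ideal_exists[of ?L] by blast
  have "\<one> \<oplus> a = \<one> \<otimes> (\<one> \<oplus> a)" using aD(1) by simp
  then have "\<one> \<oplus> a \<in> M" using M(2) by blast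
  then have "(\<one> \<oplus> a) \<ominus> a \<in> M"
    using left_ideal_minus M(1) aD(2)[OF M(1)] unfolding maximal_left_ideal_def by simp
  moreover have "(\<one> \<oplus> a) \<ominus> a = \<one>" using aD(1) add_diff_cancels(1)[of a \<one>] by (simp add: a_comm)
  ultimately show False using maximal_left_ideal_one_notin[OF M(1)] by simp
qed

text \<open>A left inverse \<open>b\<close> of \<open>1 + a\<close> is itself \<open>1 - ba\<close> and so also left invertible; having inverses
  on both sides, it is a unit.\<close>

lemma one_plus_jacobson_radical_unit:
  assumes a: "a \<in> jacobson_radical R"
  shows "\<one> \<oplus> a \<in> Units R"
proof -
  have ac: "a \<in> carrier R" using jacobson_radicalD(1)[OF a] .
  obtain b where b: "b \<in> carrier R" "b \<otimes> (\<one> \<oplus> a) = \<one>"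
    using jacobson_radical_left_inverse[OF a] .
  have "(\<ominus> b) \<otimes> a \<in> jacobson_radical R"
    using left_idealD(4)[OF left_ideal_jacobson_radical a] b(1) by simp
  then obtain c where c: "c \<in> carrier R" "c \<otimes> (\<one> \<oplus> (\<ominus> b) \<otimes> a) = \<one>"
    using jacobson_radical_left_inverse by metis
  have "\<one> \<oplus> (\<ominus> b) \<otimes> a = b \<otimes> (\<one> \<oplus> a) \<oplus> (\<ominus> b) \<otimes> a" using b by simp
  also have "\<dots> = b" using b(1) ac by (simp add: r_distr l_minus a_assoc r_neg)
  finally have cb: "c \<otimes> b = \<one>" using c by simp
  have "c = c \<otimes> (b \<otimes> (\<one> \<oplus> a))" using b c by simp
  also have "\<dots> = \<one> \<oplus> a" using cb b(1) c(1) ac by (simp add: m_assoc[symmetric])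
  finally show ?thesis using b cb ac unfolding Units_def by auto
qed

section \<open>Nilpotent elements and idempotents\<close>

lemma Units_of_one_sided_inverses:
  assumes "x \<in> carrier R" "a \<in> carrier R" "b \<in> carrier R"
    and "x \<otimes> a = \<one>" "b \<otimes> x = \<one>"
  shows "x \<in> Units R"
proof -
  have "a = b" using inv_unique[of b x a] assms by simp
  then show ?thesis using assms unfolding Units_def by auto
qed

lemma Units_of_mult:
  assumes x: "x \<in> carrier R" "y \<in> carrier R"
    and u: "x \<otimes> y \<in> Units R" "y \<otimes> x \<in> Units R"
  shows "x \<in> Units R"
proof (rule Units_of_one_sided_inverses)
  show "x \<otimes> (y \<otimes> inv (x \<otimes> y)) = \<one>" using x u by (simp add: m_assoc[symmetric])
  show "(inv (y \<otimes> x) \<otimes> y) \<otimes> x = \<one>" using x u by (simp add: m_assoc)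
qed (use x u in auto)

text \<open>The factor \<open>s\<close> is the geometric sum \<open>1 + d + \<dots> + d\<^sup>n\<^sup>-\<^sup>1\<close>.\<close>

lemma geometric_sum_factorization:
  fixes n :: nat
  assumes d: "d \<in> carrier R"
  obtains s where "s \<in> carrier R"
    "(\<one> \<ominus> d) \<otimes> s = \<one> \<ominus> d [^] n" "s \<otimes> (\<one> \<ominus> d) = \<one> \<ominus> d [^] n"
proof -
  have "\<exists>s\<in>carrier R. (\<one> \<ominus> d) \<otimes> s = \<one> \<ominus> d [^] n \<and> s \<otimes> (\<one> \<ominus> d) = \<one> \<ominus> d [^] n"
  proof (induction n)
    case 0
    then show ?case using d by (intro bexI[of _ \<zero>]) (auto simp: minus_eq r_neg)
  next
    case (Suc n)
    then obtain s where s: "s \<in> carrier R" "(\<one> \<ominus> d) \<otimes> s = \<one> \<ominus> d [^] n"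
      "s \<otimes> (\<one> \<ominus> d) = \<one> \<ominus> d [^] n" by blast
    define p where "p = d [^] n"
    have p: "p \<in> carrier R" "d \<otimes> p = p \<otimes> d" "d [^] Suc n = p \<otimes> d"
      using d nat_pow_Suc2[OF d, of n] unfolding p_def by auto
    have telescope: "(\<one> \<ominus> p) \<oplus> (p \<ominus> p \<otimes> d) = \<one> \<ominus> p \<otimes> d" using p(1) d by algebra
    have "(\<one> \<ominus> d) \<otimes> (s \<oplus> p) = (\<one> \<ominus> d) \<otimes> s \<oplus> (\<one> \<ominus> d) \<otimes> p"
      using p(1) d s(1) by (simp add: r_distr)
    also have "\<dots> = (\<one> \<ominus> p) \<oplus> (p \<ominus> p \<otimes> d)"
      using p(1) d s(2) p(2) by (simp add: minus_eq l_distr l_minus p_def)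
    finally have 1: "(\<one> \<ominus> d) \<otimes> (s \<oplus> p) = \<one> \<ominus> p \<otimes> d" using telescope by simp
    have "(s \<oplus> p) \<otimes> (\<one> \<ominus> d) = s \<otimes> (\<one> \<ominus> d) \<oplus> p \<otimes> (\<one> \<ominus> d)"
      using p(1) d s(1) by (simp add: l_distr)
    also have "\<dots> = (\<one> \<ominus> p) \<oplus> (p \<ominus> p \<otimes> d)"
      using p(1) d s(3) by (simp add: minus_eq r_distr r_minus p_def)
    finally have 2: "(s \<oplus> p) \<otimes> (\<one> \<ominus> d) = \<one> \<ominus> p \<otimes> d" using telescope by simp
    show ?case using 1 2 s p by (intro bexI[of _ "s \<oplus> p"]) auto
  qed
  then show ?thesis using that by blast
qed

lemma one_minus_nilpotent_unit:
  fixes n :: nat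
  assumes "d \<in> carrier R" "d [^] n = \<zero>"
  shows "\<one> \<ominus> d \<in> Units R"
proof -
  obtain s where s: "s \<in> carrier R" "(\<one> \<ominus> d) \<otimes> s = \<one>" "s \<otimes> (\<one> \<ominus> d) = \<one>"
    using geometric_sum_factorization[OF assms(1), of n] assms(2) by (auto simp: minus_eq)
  then show ?thesis using assms(1) unfolding Units_def by auto
qed

text \<open>Since \<open>ff = f\<close> and \<open>f(1 - f) = 0\<close>, the product on the left is \<open>efe + (1 - e)(1 - f)(1 - e)\<close>,
  and both sides expand to \<open>1 - e - f + ef + fe\<close>. The right-hand side is symmetric in \<open>e\<close> and
  \<open>f\<close>, so the same identity serves for the product in the other order.\<close>

lemma idempotent_products:
  assumes e: "e \<in> carrier R" "e \<otimes> e = e" and f: "f \<in> carrier R" "f \<otimes> f = f"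
  shows "(e \<otimes> f \<oplus> (\<one> \<ominus> e) \<otimes> (\<one> \<ominus> f)) \<otimes> (f \<otimes> e \<oplus> (\<one> \<ominus> f) \<otimes> (\<one> \<ominus> e))
    = \<one> \<ominus> (f \<ominus> e) \<otimes> (f \<ominus> e)"
proof -
  have [simp]: "e \<otimes> (e \<otimes> x) = e \<otimes> x" "f \<otimes> (f \<otimes> x) = f \<otimes> x" if "x \<in> carrier R" for x
    using that e f by (simp_all add: m_assoc[symmetric])
  show ?thesis
    using e f by (simp add: ring_simprules)
qed

lemma idempotents_conjugate:
  fixes n :: nat
  assumes e: "e \<in> carrier R" "e \<otimes> e = e" and f: "f \<in> carrier R" "f \<otimes> f = f"
    and nil: "(f \<ominus> e) [^] n = \<zero>"
  obtains u where "u \<in> Units R" "e \<otimes> u = u \<otimes> f"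
proof
  let ?u = "e \<otimes> f \<oplus> (\<one> \<ominus> e) \<otimes> (\<one> \<ominus> f)"
  let ?v = "f \<otimes> e \<oplus> (\<one> \<ominus> f) \<otimes> (\<one> \<ominus> e)"
  let ?d = "(f \<ominus> e) \<otimes> (f \<ominus> e)"
  have d: "?d \<in> carrier R" using e f by simp
  \<comment> \<open>The exponent \<open>n\<close> for \<open>f - e\<close> also kills its square.\<close>
  have "?d [^] n = (f \<ominus> e) [^] n \<otimes> (f \<ominus> e) [^] n"
    using e f by (intro pow_mult_distrib) auto
  then have "?d [^] n = \<zero>" using nil by simp
  then have unit: "\<one> \<ominus> ?d \<in> Units R" using one_minus_nilpotent_unit d by blast
  have "(e \<ominus> f) \<otimes> (e \<ominus> f) = ?d"
    using e(1) f(1) by algebra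
  then have "?u \<otimes> ?v \<in> Units R" "?v \<otimes> ?u \<in> Units R"
    using idempotent_products[OF e f] idempotent_products[OF f e] unit by simp_all
  then show "?u \<in> Units R" using Units_of_mult[of ?u ?v] e f by simp
  have "e \<otimes> ((\<one> \<ominus> e) \<otimes> (\<one> \<ominus> f)) = \<zero>"
    using e f by (simp add: m_assoc[symmetric] minus_eq r_distr r_minus r_neg)
  moreover have "((\<one> \<ominus> e) \<otimes> (\<one> \<ominus> f)) \<otimes> f = \<zero>"
    using e f by (simp add: m_assoc minus_eq l_distr l_minus r_neg)
  ultimately show "e \<otimes> ?u = ?u \<otimes> f"
    using e f by (simp add: r_distr l_distr m_assoc) (simp add: m_assoc[symmetric])
qed

lemma idempotent_conjugate:
  assumes "idempotent_elem R e" "w \<in> Units R"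
  shows "idempotent_elem R (inv w \<otimes> e \<otimes> w)"
proof -
  have e: "e \<in> carrier R" "e \<otimes> e = e" and w: "w \<in> carrier R" "inv w \<in> carrier R"
    using assms unfolding idempotent_elem_def by auto
  have "(inv w \<otimes> e \<otimes> w) \<otimes> (inv w \<otimes> e \<otimes> w) = inv w \<otimes> e \<otimes> (w \<otimes> inv w) \<otimes> e \<otimes> w"
    using e(1) w by (simp only: m_assoc m_closed)
  also have "\<dots> = inv w \<otimes> (e \<otimes> e) \<otimes> w"
    using e(1) w assms(2) by (simp add: m_assoc)
  finally show ?thesis using e w unfolding idempotent_elem_def by simp
qed

end

section \<open>Passing to the quotient by the Jacobson radical\<close>

text \<open>The quotient enters only through its projection \<open>h\<close>, which spares all computations with
  cosets.\<close>

locale jacobson_quotient = ring_hom_ring +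
  assumes surj: "h ` carrier R = carrier S"
    and kernel_iff: "a \<in> carrier R \<Longrightarrow> h a = \<zero>\<^bsub>S\<^esub> \<longleftrightarrow> a \<in> jacobson_radical R"
begin

lemma preimage:
  assumes "y \<in> carrier S"
  obtains x where "x \<in> carrier R" "y = h x"
  using assms surj by blast

lemma hom_diff: "a \<in> carrier R \<Longrightarrow> b \<in> carrier R \<Longrightarrow> h (a \<ominus> b) = h a \<ominus>\<^bsub>S\<^esub> h b"
  by (simp add: R.minus_eq S.minus_eq)

lemma hom_eq_iff:
  assumes "a \<in> carrier R" "b \<in> carrier R"
  shows "h a = h b \<longleftrightarrow> a \<ominus> b \<in> jacobson_radical R"
  using kernel_iff[of "a \<ominus> b"] hom_diff[OF assms] assms S.r_right_minus_eq by simp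

text \<open>Lift the inverse of \<open>h x\<close> to some \<open>y\<close>. Then \<open>xy\<close> and \<open>yx\<close> are congruent to \<open>\<one>\<close> modulo the
  radical, hence units.\<close>

lemma unit_lift:
  assumes x: "x \<in> carrier R" and hx: "h x \<in> Units S"
  shows "x \<in> Units R"
proof -
  obtain y where y: "y \<in> carrier R" "inv\<^bsub>S\<^esub> h x = h y"
    using preimage S.Units_inv_closed[OF hx] by metis
  have unit: "a \<in> Units R" if "a \<in> carrier R" "h a = \<one>\<^bsub>S\<^esub>" for a
  proof -
    have "a \<ominus> \<one> \<in> jacobson_radical R" using that hom_eq_iff[of a \<one>] by simp
    then have "\<one> \<oplus> (a \<ominus> \<one>) \<in> Units R" by (rule R.one_plus_jacobson_radical_unit)
    moreover have "\<one> \<oplus> (a \<ominus> \<one>) = a"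
      using that by (simp add: R.add_diff_cancels)
    ultimately show ?thesis by simp
  qed
  show ?thesis
  proof (rule R.Units_of_mult)
    show "x \<otimes> y \<in> Units R" using x y hx S.Units_r_inv[OF hx] by (intro unit) auto
    show "y \<otimes> x \<in> Units R" using x y hx S.Units_l_inv[OF hx] by (intro unit) auto
  qed (use x y in auto)
qed

lemma left_ideal_image:
  assumes "left_ideal I R"
  shows "left_ideal (h ` I) S"
proof (rule S.left_idealI)
  note ID = left_idealD[OF assms]
  show "h ` I \<subseteq> carrier S" using ID(1) by auto
  show "\<zero>\<^bsub>S\<^esub> \<in> h ` I" using ID(2) hom_zero by (metis imageI)
next
  note ID = left_idealD[OF assms]
  fix a b assume "a \<in> h ` I" "b \<in> h ` I"
  then obtain x y where *: "x \<in> I" "y \<in> I" "a = h x" "b = h y" by blast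
  then have "a \<oplus>\<^bsub>S\<^esub> b = h (x \<oplus> y)" using ID(1) by (metis hom_add subsetD)
  then show "a \<oplus>\<^bsub>S\<^esub> b \<in> h ` I" using ID(3) * by blast
next
  note ID = left_idealD[OF assms]
  fix a r assume "a \<in> h ` I" "r \<in> carrier S"
  then obtain x s where *: "x \<in> I" "a = h x" "s \<in> carrier R" "r = h s"
    using preimage[of r] by blast
  then have "r \<otimes>\<^bsub>S\<^esub> a = h (s \<otimes> x)" using ID(1) by (metis hom_mult subsetD)
  then show "r \<otimes>\<^bsub>S\<^esub> a \<in> h ` I" using ID(4) * by blast
qed

lemma left_ideal_vimage:
  assumes "left_ideal I S"
  shows "left_ideal {x \<in> carrier R. h x \<in> I} R"
  by (rule R.left_idealI) (use left_idealD[OF assms] in auto)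

text \<open>Every maximal left ideal contains the kernel of \<open>h\<close>, so it is the full preimage of its image.
  This is why maximality passes to the image in the lemma that follows.\<close>

lemma in_maximal_left_ideal_iff:
  assumes M: "maximal_left_ideal M R" and a: "a \<in> carrier R"
  shows "h a \<in> h ` M \<longleftrightarrow> a \<in> M"
proof
  have LM: "left_ideal M R" using M unfolding maximal_left_ideal_def by blast
  assume "h a \<in> h ` M"
  then obtain m where m: "m \<in> M" "h a = h m" by blast
  have mc: "m \<in> carrier R" using m left_idealD(1)[OF LM] by blast
  have "a \<ominus> m \<in> M" using m(2) hom_eq_iff[OF a mc] R.jacobson_radicalD(2) M by blast
  then have "(a \<ominus> m) \<oplus> m \<in> M" using left_idealD(3)[OF LM] m by blast
  moreover have "(a \<ominus> m) \<oplus> m = a" using a mc by (simp add: R.add_diff_cancels)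
  ultimately show "a \<in> M" by simp
qed blast

lemma maximal_left_ideal_image:
  assumes M: "maximal_left_ideal M R"
  shows "maximal_left_ideal (h ` M) S"
proof -
  have LM: "left_ideal M R"
    and max: "\<And>K. left_ideal K R \<Longrightarrow> M \<subseteq> K \<Longrightarrow> K = M \<or> K = carrier R"
    using M unfolding maximal_left_ideal_def by blast+
  have "h \<one> \<notin> h ` M"
    using in_maximal_left_ideal_iff[OF M] R.maximal_left_ideal_one_notin[OF M] by blast
  then have ne: "h ` M \<noteq> carrier S" by auto
  have "K = h ` M \<or> K = carrier S" if K: "left_ideal K S" "h ` M \<subseteq> K" for K
  proof -
    let ?P = "{x \<in> carrier R. h x \<in> K}"
    have "h ` ?P = h ` carrier R \<inter> K" by auto
    also have "\<dots> = K" using left_idealD(1)[OF K(1)] surj by auto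
    finally have "h ` ?P = K" .
    moreover have "?P = M \<or> ?P = carrier R"
      using max[OF left_ideal_vimage[OF K(1)]] K(2) left_idealD(1)[OF LM] by blast
    ultimately show ?thesis using surj by auto
  qed
  then show ?thesis
    using left_ideal_image[OF LM] ne unfolding maximal_left_ideal_def by blast
qed

text \<open>The images of the maximal left ideals of \<open>R\<close> are already enough to cut the radical of \<open>S\<close>
  down to zero: an element \<open>h a\<close> in all of them has \<open>a\<close> in every maximal left ideal of \<open>R\<close>.\<close>

lemma jacobson_radical_quotient: "jacobson_radical S = {\<zero>\<^bsub>S\<^esub>}"
proof
  show "{\<zero>\<^bsub>S\<^esub>} \<subseteq> jacobson_radical S"
    using left_idealD(2)[OF S.left_ideal_jacobson_radical] by simp
  show "jacobson_radical S \<subseteq> {\<zero>\<^bsub>S\<^esub>}"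
  proof
    fix b assume b: "b \<in> jacobson_radical S"
    obtain a where a: "a \<in> carrier R" "b = h a"
      using preimage S.jacobson_radicalD(1)[OF b] by metis
    have "a \<in> M" if M: "maximal_left_ideal M R" for M
      using S.jacobson_radicalD(2)[OF b maximal_left_ideal_image[OF M]]
        in_maximal_left_ideal_iff[OF M] a by simp
    then have "a \<in> jacobson_radical R" using R.jacobson_radicalI a by blast
    then show "b \<in> {\<zero>\<^bsub>S\<^esub>}" using a kernel_iff by simp
  qed
qed

lemma sqrtJ_iff:
  assumes "z \<in> carrier R"
  shows "h z \<in> sqrtJ S \<longleftrightarrow> z \<in> sqrtJ R"
  using assms kernel_iff[OF R.nat_pow_closed[OF assms]]
  unfolding sqrtJ_def by (simp add: jacobson_radical_quotient hom_nat_pow[symmetric])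

text \<open>For \<open>x = e + z\<close> with idempotent image, a unit conjugating \<open>h e\<close> into \<open>h x\<close> lifts to a unit
  \<open>w\<close>, and the idempotent lifting \<open>h x\<close> is \<open>w\<^sup>-\<^sup>1ew\<close>.\<close>

lemma idempotents_lift_if_clean:
  assumes clean: "\<And>x. x \<in> carrier R \<Longrightarrow> sqrtJ_clean R x"
  shows "idempotents_lift_mod R (jacobson_radical R)"
  unfolding idempotents_lift_mod_def
proof (intro ballI impI)
  fix x assume x: "x \<in> carrier R" and "x \<otimes> x \<ominus> x \<in> jacobson_radical R"
  then have idem: "h x \<otimes>\<^bsub>S\<^esub> h x = h x" using hom_eq_iff[of "x \<otimes> x" x] by simp
  obtain e z where e: "idempotent_elem R e" and z: "z \<in> sqrtJ R" and xez: "x = e \<oplus> z"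
    using clean[OF x] unfolding sqrtJ_clean_def by blast
  have ec: "e \<in> carrier R" "e \<otimes> e = e" and zc: "z \<in> carrier R"
    using e z unfolding idempotent_elem_def sqrtJ_def by auto
  have "h z = h x \<ominus>\<^bsub>S\<^esub> h e"
    using xez ec(1) zc by (simp add: S.add_diff_cancels)
  moreover obtain n :: nat where "h z [^]\<^bsub>S\<^esub> n = \<zero>\<^bsub>S\<^esub>"
    using z sqrtJ_iff[OF zc] unfolding sqrtJ_def jacobson_radical_quotient by blast
  ultimately have nil: "(h x \<ominus>\<^bsub>S\<^esub> h e) [^]\<^bsub>S\<^esub> n = \<zero>\<^bsub>S\<^esub>" by simp
  have he: "h e \<otimes>\<^bsub>S\<^esub> h e = h e" using ec hom_mult[of e e] by simp
  obtain u where u: "u \<in> Units S" "h e \<otimes>\<^bsub>S\<^esub> u = u \<otimes>\<^bsub>S\<^esub> h x"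
    using S.idempotents_conjugate[OF _ he _ idem nil] ec x by auto
  obtain w where w: "w \<in> carrier R" "u = h w" using preimage S.Units_closed[OF u(1)] by metis
  have wU: "w \<in> Units R" using unit_lift w u by simp
  have iw: "inv w \<in> carrier R" "h (inv w) \<otimes>\<^bsub>S\<^esub> h w = \<one>\<^bsub>S\<^esub>"
    using wU w hom_mult[of "inv w" w] by simp_all
  have "h (inv w \<otimes> e \<otimes> w) = h (inv w) \<otimes>\<^bsub>S\<^esub> (h w \<otimes>\<^bsub>S\<^esub> h x)"
    using iw(1) ec w u by (simp add: S.m_assoc)
  also have "\<dots> = h x" using iw w x by (simp add: S.m_assoc[symmetric])
  finally have "x \<ominus> inv w \<otimes> e \<otimes> w \<in> jacobson_radical R"
    using hom_eq_iff[of x "inv w \<otimes> e \<otimes> w"] iw ec w x by simp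
  then show "\<exists>e. idempotent_elem R e \<and> x \<ominus> e \<in> jacobson_radical R"
    using R.idempotent_conjugate[OF e wU] by blast
qed

lemma sqrtJ_clean_image:
  assumes "sqrtJ_clean R x"
  shows "sqrtJ_clean S (h x)"
proof -
  obtain e z where *: "e \<in> carrier R" "e \<otimes> e = e" "z \<in> sqrtJ R" "x = e \<oplus> z"
    using assms unfolding sqrtJ_clean_def idempotent_elem_def by blast
  then have zc: "z \<in> carrier R" unfolding sqrtJ_def by blast
  have "idempotent_elem S (h e)" using * hom_mult[of e e] unfolding idempotent_elem_def by simp
  moreover have "h z \<in> sqrtJ S" using sqrtJ_iff[OF zc] * by simp
  moreover have "h x = h e \<oplus>\<^bsub>S\<^esub> h z" using * zc by simp
  ultimately show ?thesis unfolding sqrtJ_clean_def by blast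
qed

lemma sqrtJ_clean_lift:
  assumes lift: "idempotents_lift_mod R (jacobson_radical R)"
    and x: "x \<in> carrier R" and clean: "sqrtJ_clean S (h x)"
  shows "sqrtJ_clean R x"
proof -
  obtain f q where f: "f \<in> carrier S" "f \<otimes>\<^bsub>S\<^esub> f = f" and q: "q \<in> sqrtJ S" and hx: "h x = f \<oplus>\<^bsub>S\<^esub> q"
    using clean unfolding sqrtJ_clean_def idempotent_elem_def by blast
  obtain y where y: "y \<in> carrier R" "f = h y" using preimage f(1) by metis
  have "y \<otimes> y \<ominus> y \<in> jacobson_radical R" using hom_eq_iff[of "y \<otimes> y" y] f y by simp
  then obtain e where e: "idempotent_elem R e" "y \<ominus> e \<in> jacobson_radical R"
    using lift y unfolding idempotents_lift_mod_def by blast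
  have ec: "e \<in> carrier R" using e unfolding idempotent_elem_def by blast
  have he: "h e = f" using hom_eq_iff[OF y(1) ec] e y by simp
  have qc: "q \<in> carrier S" using q unfolding sqrtJ_def by blast
  have "h (x \<ominus> e) = (f \<oplus>\<^bsub>S\<^esub> q) \<ominus>\<^bsub>S\<^esub> f" using hom_diff[OF x ec] hx he by simp
  also have "\<dots> = q" using f(1) qc by (simp add: S.add_diff_cancels)
  finally have "x \<ominus> e \<in> sqrtJ R" using sqrtJ_iff[of "x \<ominus> e"] q x ec by simp
  moreover have "x = e \<oplus> (x \<ominus> e)"
    using x ec by (simp add: R.add_diff_cancels)
  ultimately show ?thesis using e(1) unfolding sqrtJ_clean_def by blast
qed

end

lemma (in ring) jacobson_quotient_projection:
  "jacobson_quotient R (R Quot (jacobson_radical R)) ((+>) (jacobson_radical R))"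
proof -
  interpret J: ideal "jacobson_radical R" R by (rule ideal_jacobson_radical)
  interpret Q: ring_hom_ring R "R Quot (jacobson_radical R)" "(+>) (jacobson_radical R)"
    by (rule J.rcos_ring_hom_ring)
  show ?thesis
  proof
    show "(+>) (jacobson_radical R) ` carrier R = carrier (R Quot (jacobson_radical R))"
      unfolding FactRing_simps by auto
    fix a assume a: "a \<in> carrier R"
    have "jacobson_radical R +> a = jacobson_radical R +> \<zero> \<longleftrightarrow> a \<ominus> \<zero> \<in> jacobson_radical R"
      using quotient_eq_iff_same_a_r_cos[OF ideal_jacobson_radical a zero_closed] by simp
    then show "jacobson_radical R +> a = \<zero>\<^bsub>R Quot (jacobson_radical R)\<^esub>
        \<longleftrightarrow> a \<in> jacobson_radical R"
      using a by (simp add: minus_eq)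
  qed
qed

theorem theorem2p7:
  fixes R :: "('a, 'b) ring_scheme" (structure)
  assumes "ring R" and "\<one> \<noteq> \<zero>"
  shows "sqrtJ_clean_ring R \<longleftrightarrow>
    sqrtJ_clean_ring (R Quot (jacobson_radical R)) \<and>
    idempotents_lift_mod R (jacobson_radical R)"
proof -
  let ?Q = "R Quot (jacobson_radical R)"
  interpret ring R by fact
  interpret Q: jacobson_quotient R ?Q "(+>) (jacobson_radical R)"
    by (rule jacobson_quotient_projection)
  have nonzero: "\<one>\<^bsub>?Q\<^esub> \<noteq> \<zero>\<^bsub>?Q\<^esub>"
    using Q.kernel_iff[of \<one>] one_notin_jacobson_radical[OF assms(2)] by simp
  show ?thesis
  proof (intro iffI conjI)
    assume R: "sqrtJ_clean_ring R"
    then have clean: "sqrtJ_clean R x" if "x \<in> carrier R" for x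
      using that unfolding sqrtJ_clean_ring_def by blast
    show "idempotents_lift_mod R (jacobson_radical R)"
      using Q.idempotents_lift_if_clean clean .
    have "sqrtJ_clean ?Q y" if "y \<in> carrier ?Q" for y
      using that Q.preimage Q.sqrtJ_clean_image clean by metis
    then show "sqrtJ_clean_ring ?Q"
      using nonzero Q.S.ring_axioms unfolding sqrtJ_clean_ring_def by blast
  next
    assume "sqrtJ_clean_ring ?Q \<and> idempotents_lift_mod R (jacobson_radical R)"
    then have "sqrtJ_clean R x" if "x \<in> carrier R" for x
      using that Q.sqrtJ_clean_lift Q.hom_closed unfolding sqrtJ_clean_ring_def by blast
    then show "sqrtJ_clean_ring R"
      using assms unfolding sqrtJ_clean_ring_def by blast
  qed
qed

end
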